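(* Let $(\mathcal X,p(y|x),\mathcal Y)$ be a discrete memoryless channel and $p_0(x)$ an input distribution. Let $\mathbf C$ be the random codebook of rate $R>0$ and block length $n$ generated according to $p_0(x)$ with only $\epsilon$-strongly typical codewords reserved, and let $Y^n$ be the channel output when $\mathbf C$ is used. Then $$\lim_{n\to\infty}\frac1nH(Y^n|\mathbf C)=\begin{cases}H_0(Y)&\text{when }R>I_0(X;Y),\\ R+H_0(Y|X)&\text{when }R<I_0(X;Y).\end{cases}$$ In contrast, without the codebook information, $$\lim_{n\to\infty}\frac1nH(Y^n)=H_0(Y)\quad\text{for any }R>0.$$
   Context: $\mathcal X,\mathcal Y$ are finite alphabets; the memoryless channel has $p(y^n|x^n)=\prod_k p(y_k|x_k)$. Logarithms are base 2. $H_0(Y)$, $I_0(X;Y)$, $H_0(Y|X)$ are computed from $p_0(x,y)=p_0(x)p(y|x)$. $2^{nR}$ is treated as an integer. For $\epsilon>0$, $A^{(n)}_{\epsilon,0}(X)$ (the $\epsilon$-strongly typical sequences) is the set of $x^n\in\mathcal X^n$ with $|\frac1nN(a|x^n)-p_0(a)|<\epsilon/|\mathcal X|$ for all $a$ with $p_0(a)>0$ and $N(a|x^n)=0$ for all $a$ with $p_0(a)=0$, where $N(a|x^n)$ is the number of occurrences of $a$ in $x^n$. Random codebook generation: $\mathbf C=\{X^n(w): w=1,\dots,2^{nR}\}$ where the codewords are independent, each with distribution $p(x^n)=\Pr(\tilde X^n=x^n\mid\tilde X^n\in A^{(n)}_{\epsilon,0}(X))$, $\tilde X^n$ i.i.d.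 according to $p_0(x)$; here $\epsilon>0$ is fixed. The message $W$ is uniform on $\{1,\dots,2^{nR}\}$, independent of $\mathbf C$; the channel input is $X^n=X^n(W)$ and $Y^n$ is the resulting channel output. $H(Y^n|\mathbf C)=\sum_{\mathcal C}\Pr(\mathbf C=\mathcal C)H(Y^n|\mathbf C=\mathcal C)$. *)

theory Defs
  imports "HOL-Probability.Probability"
begin

section \<open>Information measures, in bits\<close>

abbreviation entropy2 :: "'s pmf \<Rightarrow> ('s \<Rightarrow> 'v) \<Rightarrow> real" where
  "entropy2 P Y \<equiv> prob_space.entropy (measure_pmf P) 2 (count_space UNIV) Y"

abbreviation conditional_entropy2 :: "'s pmf \<Rightarrow> ('s \<Rightarrow> 'v) \<Rightarrow> ('s \<Rightarrow> 'u) \<Rightarrow> real" where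
  "conditional_entropy2 P Y X \<equiv>
     prob_space.conditional_entropy (measure_pmf P) 2 (count_space UNIV) (count_space UNIV) Y X"

abbreviation mutual_information2 :: "'s pmf \<Rightarrow> ('s \<Rightarrow> 'u) \<Rightarrow> ('s \<Rightarrow> 'v) \<Rightarrow> real" where
  "mutual_information2 P X Y \<equiv>
     prob_space.mutual_information (measure_pmf P) 2 (count_space UNIV) (count_space UNIV) X Y"

text \<open>
  Blocks and codebooks below are functions on \<^typ>\<open>nat\<close>, so their types are uncountable and the
  counting measures on them are not sigma-finite. The entropy of a random variable with finitely
  many values is nevertheless the usual sum.
\<close>

lemma entropy2_eq_sum:
  assumes fin: "finite (set_pmf (map_pmf Y P))"
  shows "entropy2 P Y =
    - (\<Sum>y\<in>set_pmf (map_pmf Y P). pmf (map_pmf Y P) y * log 2 (pmf (map_pmf Y P) y))"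
proof -
  let ?Q = "map_pmf Y P"
  let ?R = "RN_deriv (count_space UNIV) (measure_pmf ?Q)"
  have dens: "density (count_space UNIV) ?R = measure_pmf ?Q"
    by (rule RN_derivI[OF _ measure_pmf_eq_density[symmetric]]) simp
  have R: "?R y = ennreal (pmf ?Q y)" for y
  proof -
    have "ennreal (pmf ?Q y) = emeasure (density (count_space UNIV) ?R) {y}"
      unfolding dens by (simp add: emeasure_pmf_single)
    also have "\<dots> = ?R y"
      by (simp add: emeasure_density nn_integral_count_space_indicator[symmetric]
          nn_integral_count_space_finite)
    finally show ?thesis by simp
  qed
  have "entropy2 P Y = - measure_pmf.expectation ?Q (\<lambda>y. log 2 (pmf ?Q y))"
    by (simp add: prob_space.entropy_def[OF prob_space_measure_pmf] KL_divergence_def entropy_density_def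
        map_pmf_rep_eq[symmetric] R)
  also have "\<dots> = - (\<Sum>y\<in>set_pmf ?Q. pmf ?Q y * log 2 (pmf ?Q y))"
    by (subst integral_measure_pmf[OF fin]) auto
  finally show ?thesis .
qed

text \<open>
  The entropy of \<open>Y\<close> given a codebook-valued \<open>C\<close>, as the average of the entropies of the
  conditional laws. The library's conditional entropy is not used here because it refers to the
  product of the two (non-sigma-finite) counting measures.
\<close>

definition avg_conditional_entropy2 :: "'s pmf \<Rightarrow> ('s \<Rightarrow> 'v) \<Rightarrow> ('s \<Rightarrow> 'u) \<Rightarrow> real" where
  "avg_conditional_entropy2 P Y C =
     (\<Sum>c\<in>set_pmf (map_pmf C P). measure_pmf.prob P {s. C s = c} * entropy2 (cond_pmf P {s. C s = c}) Y)"

section \<open>Memoryless channels and typical sequences\<close>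

text \<open>
  A channel is a map \<open>ch\<close> with \<open>p(y|x) = pmf (ch x) y\<close>. A block of length \<open>n\<close> is a function on
  \<open>{..<n}\<close> that is \<^const>\<open>undefined\<close> elsewhere.
\<close>

definition joint_pmf :: "'a pmf \<Rightarrow> ('a \<Rightarrow> 'b pmf) \<Rightarrow> ('a \<times> 'b) pmf" where
  "joint_pmf p0 ch = do {x \<leftarrow> p0; y \<leftarrow> ch x; return_pmf (x, y)}"

definition iid_pmf :: "nat \<Rightarrow> 'a pmf \<Rightarrow> (nat \<Rightarrow> 'a) pmf" where
  "iid_pmf n p = Pi_pmf {..<n} undefined (\<lambda>_. p)"

definition memoryless :: "('a \<Rightarrow> 'b pmf) \<Rightarrow> nat \<Rightarrow> (nat \<Rightarrow> 'a) \<Rightarrow> (nat \<Rightarrow> 'b) pmf" where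
  "memoryless ch n x = Pi_pmf {..<n} undefined (\<lambda>k. ch (x k))"

definition occurrences :: "nat \<Rightarrow> 'a \<Rightarrow> (nat \<Rightarrow> 'a) \<Rightarrow> nat" where
  "occurrences n a x = card {k. k < n \<and> x k = a}"

definition strongly_typical :: "'a::finite pmf \<Rightarrow> real \<Rightarrow> nat \<Rightarrow> (nat \<Rightarrow> 'a) set" where
  "strongly_typical p0 \<epsilon> n =
     {x \<in> {..<n} \<rightarrow>\<^sub>E UNIV. \<forall>a.
        (pmf p0 a > 0 \<longrightarrow> \<bar>real (occurrences n a x) / real n - pmf p0 a\<bar> < \<epsilon> / real CARD('a)) \<and>
        (pmf p0 a = 0 \<longrightarrow> occurrences n a x = 0)}"

section \<open>Random coding with typical codewords\<close>

text \<open>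
  The conditioning event may be null for finitely many \<open>n\<close>, in which case \<^const>\<open>cond_pmf\<close>
  returns an unspecified distribution.
\<close>

definition codeword_pmf :: "'a::finite pmf \<Rightarrow> real \<Rightarrow> nat \<Rightarrow> (nat \<Rightarrow> 'a) pmf" where
  "codeword_pmf p0 \<epsilon> n = cond_pmf (iid_pmf n p0) (strongly_typical p0 \<epsilon> n)"

text \<open>The number \<open>2\<^sup>n\<^sup>R\<close> of messages, rounded up to an integer.\<close>

definition num_messages :: "real \<Rightarrow> nat \<Rightarrow> nat" where
  "num_messages R n = nat \<lceil>2 powr (real n * R)\<rceil>"

definition codebook_pmf :: "'a::finite pmf \<Rightarrow> real \<Rightarrow> real \<Rightarrow> nat \<Rightarrow> (nat \<Rightarrow> nat \<Rightarrow> 'a) pmf" where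
  "codebook_pmf p0 \<epsilon> R n = iid_pmf (num_messages R n) (codeword_pmf p0 \<epsilon> n)"

text \<open>The joint law of the codebook \<open>C\<close>, the message \<open>W\<close> and the channel output \<open>Y\<^sup>n\<close>.\<close>

definition transmission_pmf ::
  "'a::finite pmf \<Rightarrow> ('a \<Rightarrow> 'b pmf) \<Rightarrow> real \<Rightarrow> real \<Rightarrow> nat \<Rightarrow>
     ((nat \<Rightarrow> nat \<Rightarrow> 'a) \<times> nat \<times> (nat \<Rightarrow> 'b)) pmf" where
  "transmission_pmf p0 ch \<epsilon> R n = do {
     C \<leftarrow> codebook_pmf p0 \<epsilon> R n;
     w \<leftarrow> pmf_of_set {..<num_messages R n};
     y \<leftarrow> memoryless ch n (C w);
     return_pmf (C, w, y)}"

definition codebook :: "'c \<times> 'w \<times> 'y \<Rightarrow> 'c" where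
  "codebook = (\<lambda>(C, w, y). C)"

definition output_block :: "'c \<times> 'w \<times> 'y \<Rightarrow> 'y" where
  "output_block = (\<lambda>(C, w, y). y)"

end

(*
  Both regimes are one statement: H(Y^n|C)/n tends to min (R + H(Y|X)) (H(Y)). The upper bounds are
  H(Y^n|C) <= H(Y^n) and H(Y^n|C) <= log M + H(Y^n|X^n). For the lower bound fix the transmitted
  codeword x and the output y, and average -log p(y|C) over the remaining codewords only. These are
  independent of (x, y), so convexity gives at least -log (p(y|x) / M + p(y)). Conditioning on
  typicality at most doubles probabilities once the typical set has probability 1/2, so p(y) is at
  most twice the memoryless output law, and the bound becomes
  min (log M - log p(y|x)) (-log p(y)) - 2. An L1 law of large numbers with rate sqrt n applies to
  both information densities; the factor 2 carries it over to the typical codewords.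
*)
theory Submission
  imports Defs
begin

section \<open>Entropy of probability mass functions\<close>

lemma expectation_bind_pmf:
  fixes h :: "'b \<Rightarrow> real"
  assumes "finite (set_pmf p)" "\<And>x. x \<in> set_pmf p \<Longrightarrow> finite (set_pmf (f x))"
  shows "measure_pmf.expectation (bind_pmf p f) h
    = measure_pmf.expectation p (\<lambda>x. measure_pmf.expectation (f x) h)"
  using assms
  by (subst pmf_expectation_bind[of "set_pmf p"])
    (auto simp: integral_measure_pmf[of "set_pmf p"])

lemma expectation_mono_pmf:
  fixes f g :: "'a \<Rightarrow> real"
  assumes "finite (set_pmf p)" "\<And>x. x \<in> set_pmf p \<Longrightarrow> f x \<le> g x"
  shows "measure_pmf.expectation p f \<le> measure_pmf.expectation p g"
  using assms by (intro integral_mono_AE integrable_measure_pmf_finite) (auto simp: AE_measure_pmf_iff)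

lemma expectation_cong_pmf:
  fixes f g :: "'a \<Rightarrow> real"
  assumes "\<And>x. x \<in> set_pmf p \<Longrightarrow> f x = g x"
  shows "measure_pmf.expectation p f = measure_pmf.expectation p g"
  using assms by (intro integral_cong_AE) (auto simp: AE_measure_pmf_iff)

text \<open>Supplies densities with respect to counting measure, the form in which the general
  formulas for conditional entropy and mutual information take their hypotheses.\<close>

lemma distributed_pmf:
  "distributed (measure_pmf p) (count_space UNIV) X (\<lambda>x. ennreal (pmf (map_pmf X p) x))"
  unfolding distributed_def map_pmf_rep_eq[symmetric] measure_pmf_eq_density[symmetric] by simp

text \<open>Shannon entropy in bits, attached to a law instead of a random variable, and written as
  an expectation so that linearity and monotonicity apply directly.\<close>

definition pmf_entropy :: "'a pmf \<Rightarrow> real" where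
  "pmf_entropy p = measure_pmf.expectation p (\<lambda>y. - log 2 (pmf p y))"

lemma entropy2_eq_pmf_entropy:
  assumes "finite (set_pmf (map_pmf Y P))"
  shows "entropy2 P Y = pmf_entropy (map_pmf Y P)"
  unfolding entropy2_eq_sum[OF assms] pmf_entropy_def
  by (subst integral_measure_pmf[OF assms]) (auto simp: sum_negf)

lemma pmf_entropy_map_inj:
  assumes "inj_on f (set_pmf p)"
  shows "pmf_entropy (map_pmf f p) = pmf_entropy p"
  unfolding pmf_entropy_def
  by (simp del: pmf_map) (intro expectation_cong_pmf, simp add: pmf_map_inj assms)

section \<open>Single-letter entropies of the channel\<close>

lemma pmf_joint_pmf:
  "pmf (joint_pmf p0 ch) (a, b) = pmf p0 a * pmf (ch a) b"
proof -
  have "pmf (joint_pmf p0 ch) (a, b) = measure_pmf.expectation p0 (\<lambda>x. pmf (map_pmf (Pair x) (ch x)) (a, b))"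
    unfolding joint_pmf_def map_pmf_def[symmetric] pmf_bind ..
  also have "(\<lambda>x. pmf (map_pmf (Pair x) (ch x)) (a, b)) = (\<lambda>x. indicator {a} x * pmf (ch a) b)"
  proof
    fix x show "pmf (map_pmf (Pair x) (ch x)) (a, b) = indicator {a} x * pmf (ch a) b"
      by (cases "x = a") (auto simp: pmf_map_inj' inj_on_def pmf_eq_0_set_pmf)
  qed
  also have "measure_pmf.expectation p0 \<dots> = pmf p0 a * pmf (ch a) b"
    by (simp add: measure_pmf_single)
  finally show ?thesis .
qed

lemma map_fst_joint_pmf: "map_pmf fst (joint_pmf p0 ch) = p0"
  by (simp add: joint_pmf_def map_bind_pmf bind_return_pmf')

lemma map_snd_joint_pmf: "map_pmf snd (joint_pmf p0 ch) = bind_pmf p0 ch"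
  by (simp add: joint_pmf_def map_bind_pmf bind_return_pmf')

lemma information_space_pmf: "information_space (measure_pmf p) 2"
  by (simp add: information_space_def information_space_axioms_def prob_space_measure_pmf)

lemma conditional_entropy2_joint_pmf:
  fixes p0 :: "'a::finite pmf" and ch :: "'a \<Rightarrow> 'b::finite pmf"
  shows "conditional_entropy2 (joint_pmf p0 ch) snd fst
    = measure_pmf.expectation p0 (\<lambda>a. pmf_entropy (ch a))"
proof -
  let ?J = "joint_pmf p0 ch"
  interpret information_space "measure_pmf ?J" 2 by (rule information_space_pmf)
  let ?Pxy = "\<lambda>z. pmf (map_pmf (\<lambda>z. (snd z, fst z)) ?J) z"
  have P: "?Pxy (b, a) = pmf p0 a * pmf (ch a) b" for a b
    using pmf_map_inj'[of "\<lambda>z. (snd z, fst z)" ?J "(a, b)"] by (auto simp: inj_on_def pmf_joint_pmf)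
  have pair: "count_space (UNIV::'b set) \<Otimes>\<^sub>M count_space (UNIV::'a set) = count_space UNIV"
    by (simp add: pair_measure_count_space)
  have "conditional_entropy2 ?J snd fst
    = - (\<integral>(b, a). ?Pxy (b, a) * log 2 (?Pxy (b, a) / pmf (map_pmf fst ?J) a)
         \<partial>(count_space UNIV \<Otimes>\<^sub>M count_space UNIV))"
    by (intro conditional_entropy_generic_eq)
      (auto simp: pair sigma_finite_measure_count_space_finite simp del: pmf_map intro: distributed_pmf)
  also have "\<dots> = - (\<Sum>(b, a)\<in>UNIV. pmf p0 a * pmf (ch a) b * log 2 (pmf p0 a * pmf (ch a) b / pmf p0 a))"
    unfolding pair P map_fst_joint_pmf by (simp add: lebesgue_integral_count_space_finite)
  \<comment> \<open>Where \<open>pmf p0 a\<close> is zero, both sides vanish because of the factor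
    in front; elsewhere it cancels inside the logarithm.\<close>
  also have "\<dots> = - (\<Sum>b\<in>UNIV. \<Sum>a\<in>UNIV. pmf p0 a * (pmf (ch a) b * log 2 (pmf (ch a) b)))"
    by (subst UNIV_Times_UNIV[symmetric], subst sum.cartesian_product[symmetric])
      (auto intro!: sum.cong)
  also have "\<dots> = measure_pmf.expectation p0 (\<lambda>a. pmf_entropy (ch a))"
    unfolding pmf_entropy_def
    by (subst sum.swap) (simp add: integral_measure_pmf[of UNIV] sum_negf sum_distrib_left)
  finally show ?thesis .
qed

text \<open>Combines I(X;Y) = H(X) + H(Y) - H(X,Y) with H(Y|X) = H(Y,X) - H(X); the two joint
  entropies agree because entropy is invariant under the injective swap of coordinates.\<close>

lemma mutual_information2_joint_pmf:
  fixes p0 :: "'a::finite pmf" and ch :: "'a \<Rightarrow> 'b::finite pmf"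
  shows "mutual_information2 (joint_pmf p0 ch) fst snd
    = entropy2 (joint_pmf p0 ch) snd - conditional_entropy2 (joint_pmf p0 ch) snd fst"
proof -
  let ?J = "joint_pmf p0 ch"
  interpret information_space "measure_pmf ?J" 2 by (rule information_space_pmf)
  have pair: "count_space (UNIV::'a set) \<Otimes>\<^sub>M count_space (UNIV::'b set) = count_space UNIV"
             "count_space (UNIV::'b set) \<Otimes>\<^sub>M count_space (UNIV::'a set) = count_space UNIV"
    by (simp_all add: pair_measure_count_space)
  let ?H = "entropy2 ?J (\<lambda>z. (fst z, snd z))" and ?H' = "entropy2 ?J (\<lambda>z. (snd z, fst z))"
  have "mutual_information2 ?J fst snd = entropy2 ?J fst + entropy2 ?J snd
    - prob_space.entropy (measure_pmf ?J) 2 (count_space UNIV \<Otimes>\<^sub>M count_space UNIV) (\<lambda>z. (fst z, snd z))"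
    by (rule mutual_information_eq_entropy_conditional_entropy_distr[where Px="pmf (map_pmf fst ?J)"
          and Py="pmf (map_pmf snd ?J)" and Pxy="pmf (map_pmf (\<lambda>z. (fst z, snd z)) ?J)"])
      (auto simp only: pair sigma_finite_measure_count_space_finite pmf_nonneg finite
        distributed_pmf integrable_count_space)
  moreover have "conditional_entropy2 ?J snd fst
    = prob_space.entropy (measure_pmf ?J) 2 (count_space UNIV \<Otimes>\<^sub>M count_space UNIV) (\<lambda>z. (snd z, fst z)) - entropy2 ?J fst"
    by (rule conditional_entropy_eq_entropy[where Py="pmf (map_pmf fst ?J)"
          and Pxy="pmf (map_pmf (\<lambda>z. (snd z, fst z)) ?J)"])
      (auto simp only: pair sigma_finite_measure_count_space_finite pmf_nonneg finite
        distributed_pmf integrable_count_space)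
  moreover have "?H = ?H'"
    by (subst (1 2) entropy2_eq_pmf_entropy, simp, simp, subst (1 2) pmf_entropy_map_inj)
      (auto simp: inj_on_def)
  ultimately show ?thesis
    by (simp add: pair)
qed

text \<open>Concavity: the tangent of the logarithm at \<open>z0\<close> lies above its graph. Being
  affine in \<open>z\<close>, it passes through expectations and so yields Jensen's inequality with
  a freely chosen base point.\<close>

lemma log_le_tangent:
  fixes z z0 :: real
  assumes "z > 0" "z0 > 0"
  shows "log 2 z \<le> log 2 z0 + (z / z0 - 1) / ln 2"
proof -
  have "ln (z / z0) \<le> z / z0 - 1"
    using assms by (intro ln_le_minus_one) simp
  hence "ln z - ln z0 \<le> z / z0 - 1"
    using assms by (simp add: ln_div)
  hence "(ln z - ln z0) / ln 2 \<le> (z / z0 - 1) / ln 2"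
    by (intro divide_right_mono) simp_all
  thus ?thesis
    by (simp add: log_def diff_divide_distrib)
qed

text \<open>On the support of \<open>p\<close> the weights cancel the denominators.\<close>

lemma expectation_pmf_ratio_le_1:
  assumes "finite (set_pmf p)" "\<And>y. y \<in> set_pmf p \<Longrightarrow> f y \<ge> 0"
  shows "measure_pmf.expectation p (\<lambda>y. f y / pmf p y) \<le> sum f (set_pmf p)"
  by (subst integral_measure_pmf[OF assms(1)]) (auto simp: pmf_eq_0_set_pmf intro!: sum_mono)

lemma sum_pmf_le_1: "finite A \<Longrightarrow> sum (pmf p) A \<le> 1"
  by (metis measure_measure_pmf_finite measure_pmf.prob_le_1)

text \<open>Average over \<open>p\<close> the tangent of the logarithm at \<open>pmf p y\<close>,
  evaluated at \<open>pmf r y\<close>. The linear term has mean at most 0 since \<open>r\<close>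
  gives the support of \<open>p\<close> mass at most 1. The inclusion of supports keeps
  \<open>pmf r y\<close> positive.\<close>

lemma gibbs_inequality:
  assumes "finite (set_pmf p)" "set_pmf p \<subseteq> set_pmf r"
  shows "pmf_entropy p \<le> measure_pmf.expectation p (\<lambda>y. - log 2 (pmf r y))"
proof -
  note [simp] = integrable_measure_pmf_finite[OF assms(1)]
  have "measure_pmf.expectation p (\<lambda>y. log 2 (pmf r y))
     \<le> measure_pmf.expectation p (\<lambda>y. log 2 (pmf p y) + (pmf r y / pmf p y - 1) / ln 2)"
    using assms by (intro expectation_mono_pmf log_le_tangent) (auto simp: pmf_positive_iff)
  also have "\<dots> = measure_pmf.expectation p (\<lambda>y. log 2 (pmf p y))
      + (measure_pmf.expectation p (\<lambda>y. pmf r y / pmf p y) - 1) / ln 2"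
    by simp
  also have "measure_pmf.expectation p (\<lambda>y. pmf r y / pmf p y) \<le> 1"
    using expectation_pmf_ratio_le_1[OF assms(1), of "pmf r"] sum_pmf_le_1[OF assms(1), of r] by simp
  finally show ?thesis
    by (simp add: pmf_entropy_def divide_right_mono)
qed

section \<open>The mean output entropy of a random codebook\<close>

text \<open>The conditional law of the channel output given the codebook \<open>C\<close>, with the
  uniform message averaged out.\<close>

definition mixture_output :: "('x \<Rightarrow> 'y pmf) \<Rightarrow> nat \<Rightarrow> (nat \<Rightarrow> 'x) \<Rightarrow> 'y pmf" where
  "mixture_output K M C = bind_pmf (pmf_of_set {..<M}) (\<lambda>w. K (C w))"

lemma finite_set_iid_pmf [simp]: "finite (set_pmf p) \<Longrightarrow> finite (set_pmf (iid_pmf n p))"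
  unfolding iid_pmf_def by (rule finite_subset[OF set_Pi_pmf_subset'[OF finite_lessThan]]) auto

lemma set_iid_pmf_component:
  assumes "C \<in> set_pmf (iid_pmf M q)" "w < M"
  shows "C w \<in> set_pmf q"
  using assms by (auto simp: iid_pmf_def set_Pi_pmf PiE_dflt_def)

lemma expectation_iid_component:
  fixes h :: "'x \<Rightarrow> real"
  assumes "w < M"
  shows "measure_pmf.expectation (iid_pmf M q) (\<lambda>C. h (C w)) = measure_pmf.expectation q h"
proof -
  have "measure_pmf.expectation (iid_pmf M q) (\<lambda>C. h (C w))
      = measure_pmf.expectation (map_pmf (\<lambda>C. C w) (iid_pmf M q)) h"
    by simp
  thus ?thesis
    using assms by (simp add: iid_pmf_def Pi_pmf_component del: integral_map_pmf)
qed

text \<open>A one-shot setting: an element of \<open>'x\<close> stands for a whole codeword and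
  \<open>K\<close> for the channel acting on it. Block length, memorylessness and typicality enter
  only through a later instantiation.\<close>

locale random_code =
  fixes q :: "'x pmf" and K :: "'x \<Rightarrow> 'y pmf" and M :: nat
  assumes finite_q [simp]: "finite (set_pmf q)"
    and finite_K [simp]: "\<And>x. x \<in> set_pmf q \<Longrightarrow> finite (set_pmf (K x))"
    and M_pos: "M > 0"
begin

abbreviation avg_entropy :: real where
  "avg_entropy \<equiv> measure_pmf.expectation (iid_pmf M q) (\<lambda>C. pmf_entropy (mixture_output K M C))"

lemma nonempty [simp]: "{..<M} \<noteq> {}"
  using M_pos by auto

lemma finite_mixture_output:
  assumes "C \<in> set_pmf (iid_pmf M q)"
  shows "finite (set_pmf (mixture_output K M C))"
  using set_iid_pmf_component[OF assms] by (auto simp: mixture_output_def)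

lemma expectation_mixture_output:
  fixes h :: "'y \<Rightarrow> real"
  assumes "C \<in> set_pmf (iid_pmf M q)"
  shows "measure_pmf.expectation (mixture_output K M C) h
    = (\<Sum>w<M. measure_pmf.expectation (K (C w)) h) / real M"
  unfolding mixture_output_def using set_iid_pmf_component[OF assms]
  by (subst pmf_expectation_bind_pmf_of_set)
    (simp_all add: divide_inverse_commute flip: sum_distrib_left)

lemma pmf_mixture_output:
  "pmf (mixture_output K M C) y = (\<Sum>w<M. pmf (K (C w)) y) / real M"
  unfolding mixture_output_def by (simp add: pmf_bind_pmf_of_set sum_divide_distrib)

lemma pmf_mixture_output_ge:
  assumes "w < M"
  shows "pmf (K (C w)) y / real M \<le> pmf (mixture_output K M C) y"
  unfolding pmf_mixture_output using assms
  by (intro divide_right_mono member_le_sum) auto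

section \<open>Upper bounds on the mean entropy given the codebook\<close>

lemma expectation_codeword_average:
  fixes h :: "'x \<Rightarrow> real"
  shows "measure_pmf.expectation (iid_pmf M q) (\<lambda>C. (\<Sum>w<M. h (C w)) / real M)
    = measure_pmf.expectation q h"
proof -
  have "measure_pmf.expectation (iid_pmf M q) (\<lambda>C. (\<Sum>w<M. h (C w)) / real M)
      = (\<Sum>w<M. measure_pmf.expectation (iid_pmf M q) (\<lambda>C. h (C w))) / real M"
    by (simp add: integrable_measure_pmf_finite)
  also have "\<dots> = measure_pmf.expectation q h"
    using M_pos by (simp add: expectation_iid_component)
  finally show ?thesis .
qed

text \<open>Gibbs' inequality for each codebook against one fixed reference law \<open>r\<close>;
  averaged over codebooks, the mixtures become \<open>bind_pmf q K\<close>. The choice of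
  \<open>r\<close> is left open so that it can later be a product law, whose logarithm is a
  sum.\<close>

lemma avg_entropy_le_cross_entropy:
  assumes "set_pmf (bind_pmf q K) \<subseteq> set_pmf r"
  shows "avg_entropy \<le> measure_pmf.expectation (bind_pmf q K) (\<lambda>y. - log 2 (pmf r y))"
proof -
  have "avg_entropy \<le> measure_pmf.expectation (iid_pmf M q)
      (\<lambda>C. (\<Sum>w<M. measure_pmf.expectation (K (C w)) (\<lambda>y. - log 2 (pmf r y))) / real M)"
  proof (rule expectation_mono_pmf)
    fix C assume C: "C \<in> set_pmf (iid_pmf M q)"
    have "pmf_entropy (mixture_output K M C)
        \<le> measure_pmf.expectation (mixture_output K M C) (\<lambda>y. - log 2 (pmf r y))"
      using assms set_iid_pmf_component[OF C]
      by (intro gibbs_inequality finite_mixture_output[OF C]) (fastforce simp: mixture_output_def)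
    thus "pmf_entropy (mixture_output K M C)
        \<le> (\<Sum>w<M. measure_pmf.expectation (K (C w)) (\<lambda>y. - log 2 (pmf r y))) / real M"
      by (simp only: expectation_mixture_output[OF C])
  qed simp
  also have "\<dots> = measure_pmf.expectation q (\<lambda>x. measure_pmf.expectation (K x) (\<lambda>y. - log 2 (pmf r y)))"
    by (rule expectation_codeword_average)
  finally show ?thesis
    by (simp only: expectation_bind_pmf finite_q finite_K)
qed

text \<open>The mixture dominates each of its components divided by \<open>M\<close>, so knowing
  only the codebook instead of the codeword costs at most \<open>log 2 M\<close> bits of
  information.\<close>

lemma avg_entropy_le_rate:
  "avg_entropy \<le> log 2 M + measure_pmf.expectation q (\<lambda>x. pmf_entropy (K x))"
proof -
  have "avg_entropy \<le> measure_pmf.expectation (iid_pmf M q)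
      (\<lambda>C. (\<Sum>w<M. log 2 M + pmf_entropy (K (C w))) / real M)"
  proof (rule expectation_mono_pmf)
    fix C assume C: "C \<in> set_pmf (iid_pmf M q)"
    have "measure_pmf.expectation (K (C w)) (\<lambda>y. - log 2 (pmf (mixture_output K M C) y))
        \<le> log 2 M + pmf_entropy (K (C w))" if w: "w < M" for w
    proof -
      have fin: "finite (set_pmf (K (C w)))"
        using set_iid_pmf_component[OF C w] by simp
      have "measure_pmf.expectation (K (C w)) (\<lambda>y. - log 2 (pmf (mixture_output K M C) y))
        \<le> measure_pmf.expectation (K (C w)) (\<lambda>y. log 2 M + - log 2 (pmf (K (C w)) y))"
      proof (rule expectation_mono_pmf[OF fin])
        fix y assume "y \<in> set_pmf (K (C w))"
        hence pos: "pmf (K (C w)) y > 0" by (simp add: pmf_positive_iff)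
        have "log 2 (pmf (K (C w)) y / M) \<le> log 2 (pmf (mixture_output K M C) y)"
          using pos M_pos by (intro log_mono pmf_mixture_output_ge w) auto
        thus "- log 2 (pmf (mixture_output K M C) y) \<le> log 2 M + - log 2 (pmf (K (C w)) y)"
          using pos M_pos by (simp add: log_divide)
      qed
      also have "\<dots> = log 2 M + pmf_entropy (K (C w))"
        unfolding pmf_entropy_def by (subst Bochner_Integration.integral_add)
          (simp_all add: integrable_measure_pmf_finite fin)
      finally show ?thesis .
    qed
    thus "pmf_entropy (mixture_output K M C) \<le> (\<Sum>w<M. log 2 M + pmf_entropy (K (C w))) / real M"
      unfolding pmf_entropy_def[of "mixture_output K M C"] expectation_mixture_output[OF C]
      by (intro divide_right_mono sum_mono) auto
  qed simp
  also have "\<dots> = log 2 M + measure_pmf.expectation q (\<lambda>x. pmf_entropy (K x))"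
    by (subst expectation_codeword_average[of "\<lambda>x. log 2 M + pmf_entropy (K x)"])
      (simp add: integrable_measure_pmf_finite)
  finally show ?thesis .
qed

section \<open>Lower bound from convexity over the codewords not sent\<close>

lemma expectation_mixture_given_codeword:
  assumes w: "w < M" and x: "x \<in> set_pmf q"
  shows "measure_pmf.expectation (Pi_pmf ({..<M} - {w}) undefined (\<lambda>_. q))
      (\<lambda>C. pmf (mixture_output K M (C(w := x))) y)
    \<le> pmf (K x) y / real M + pmf (bind_pmf q K) y"
proof -
  let ?P = "Pi_pmf ({..<M} - {w}) undefined (\<lambda>_. q)"
  have fin: "finite (set_pmf ?P)"
    by (rule finite_subset[OF set_Pi_pmf_subset']) auto
  note [simp] = integrable_measure_pmf_finite[OF fin]
  have Q: "measure_pmf.expectation ?P (\<lambda>C. pmf (K (C v)) y) = pmf (bind_pmf q K) y"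
    if "v \<in> {..<M} - {w}" for v
  proof -
    have "measure_pmf.expectation ?P (\<lambda>C. pmf (K (C v)) y)
        = measure_pmf.expectation (map_pmf (\<lambda>C. C v) ?P) (\<lambda>x. pmf (K x) y)"
      by simp
    also have "map_pmf (\<lambda>C. C v) ?P = q"
      using that by (subst Pi_pmf_component) auto
    finally show ?thesis by (simp add: pmf_bind)
  qed
  have "(\<lambda>C. pmf (mixture_output K M (C(w := x))) y)
      = (\<lambda>C. (pmf (K x) y + (\<Sum>v\<in>{..<M} - {w}. pmf (K (C v)) y)) / real M)"
    using w by (auto simp: pmf_mixture_output sum.remove[of "{..<M}" w])
  hence "measure_pmf.expectation ?P (\<lambda>C. pmf (mixture_output K M (C(w := x))) y)
      = (pmf (K x) y + (\<Sum>v\<in>{..<M} - {w}. pmf (bind_pmf q K) y)) / real M"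
    by (simp add: Q)
  \<comment> \<open>There are \<open>M - 1\<close> other codewords; enlarging this count to
    \<open>M\<close> removes the factor \<open>(M - 1) / M\<close>.\<close>
  also have "\<dots> \<le> (pmf (K x) y + M * pmf (bind_pmf q K) y) / real M"
    using w by (intro divide_right_mono add_left_mono) (auto intro: mult_right_mono)
  also have "\<dots> = pmf (K x) y / real M + pmf (bind_pmf q K) y"
    using M_pos by (simp add: field_simps)
  finally show ?thesis .
qed

lemma avg_entropy_ge:
  "measure_pmf.expectation q (\<lambda>x. measure_pmf.expectation (K x)
      (\<lambda>y. - log 2 (pmf (K x) y / real M + pmf (bind_pmf q K) y))) \<le> avg_entropy"
proof -
  define z where "z x y = pmf (K x) y / real M + pmf (bind_pmf q K) y" for x y
  have z_pos: "z x y > 0" if "y \<in> set_pmf (K x)" for x y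
    using that M_pos unfolding z_def by (intro add_pos_nonneg) (auto simp: pmf_positive_iff)
  let ?h = "\<lambda>x. measure_pmf.expectation (K x) (\<lambda>y. - log 2 (z x y))"
  \<comment> \<open>Averaging over the codewords other than \<open>w\<close>, the tangent of \<^const>\<open>log\<close> at \<open>z x y\<close> has mean at most
    \<open>log 2 (z x y)\<close>, because \<open>z x y\<close> dominates the mean of the mixture.\<close>
  have main: "measure_pmf.expectation q ?h \<le> measure_pmf.expectation (iid_pmf M q)
      (\<lambda>C. measure_pmf.expectation (K (C w)) (\<lambda>y. - log 2 (pmf (mixture_output K M C) y)))"
    if w: "w < M" for w
  proof -
    let ?P = "Pi_pmf ({..<M} - {w}) undefined (\<lambda>_. q)"
    have fin: "finite (set_pmf ?P)"
      by (rule finite_subset[OF set_Pi_pmf_subset']) auto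
    \<comment> \<open>Independence lets the sent codeword be drawn first and the remaining ones
      separately, so that Jensen's inequality can be applied to the latter with \<open>x\<close> and
      \<open>y\<close> held fixed.\<close>
    have "iid_pmf M q = Pi_pmf (insert w ({..<M} - {w})) undefined (\<lambda>_. q)"
      using w by (simp add: iid_pmf_def insert_absorb)
    also have "\<dots> = bind_pmf q (\<lambda>x. map_pmf (\<lambda>C. C(w := x)) ?P)"
      by (subst Pi_pmf_insert') (auto simp: map_pmf_def)
    finally have iid: "iid_pmf M q = bind_pmf q (\<lambda>x. map_pmf (\<lambda>C. C(w := x)) ?P)" .
    have "measure_pmf.expectation q ?h \<le> measure_pmf.expectation q (\<lambda>x. measure_pmf.expectation ?P
        (\<lambda>C. measure_pmf.expectation (K x) (\<lambda>y. - log 2 (pmf (mixture_output K M (C(w := x))) y))))"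
    proof (rule expectation_mono_pmf[OF finite_q])
      fix x assume x: "x \<in> set_pmf q"
      let ?D = "pair_pmf ?P (K x)"
      have finD: "finite (set_pmf ?D)"
        using x fin by simp
      have "?h x \<le> measure_pmf.expectation (K x) (\<lambda>y. measure_pmf.expectation ?P
          (\<lambda>C. - log 2 (pmf (mixture_output K M (C(w := x))) y)))"
      proof (rule expectation_mono_pmf)
        fix y assume y: "y \<in> set_pmf (K x)"
        note [simp] = integrable_measure_pmf_finite[OF fin]
        \<comment> \<open>The output \<open>y\<close> is reachable from \<open>x\<close>, which is
          codeword \<open>w\<close> of every modified codebook.\<close>
        have pos: "pmf (mixture_output K M (C(w := x))) y > 0" for C
        proof -
          have "0 < pmf (K ((C(w := x)) w)) y / real M"
            using y M_pos by (simp add: pmf_positive_iff)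
          also have "\<dots> \<le> pmf (mixture_output K M (C(w := x))) y"
            by (rule pmf_mixture_output_ge[OF w])
          finally show ?thesis .
        qed
        have "measure_pmf.expectation ?P (\<lambda>C. log 2 (pmf (mixture_output K M (C(w := x))) y))
            \<le> measure_pmf.expectation ?P
                (\<lambda>C. log 2 (z x y) + (pmf (mixture_output K M (C(w := x))) y / z x y - 1) / ln 2)"
          using y by (intro expectation_mono_pmf[OF fin] log_le_tangent pos z_pos)
        also have "\<dots> = log 2 (z x y) + (measure_pmf.expectation ?P
            (\<lambda>C. pmf (mixture_output K M (C(w := x))) y) / z x y - 1) / ln 2"
          by simp
        also have "\<dots> \<le> log 2 (z x y) + (z x y / z x y - 1) / ln 2"
          using z_pos[OF y] expectation_mixture_given_codeword[OF w x, of y]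
          by (intro add_left_mono divide_right_mono diff_right_mono) (auto simp: z_def)
        finally show "- log 2 (z x y)
            \<le> measure_pmf.expectation ?P (\<lambda>C. - log 2 (pmf (mixture_output K M (C(w := x))) y))"
          using z_pos[OF y] by simp
      qed (use x in simp)
      \<comment> \<open>Exchange of the two expectations; the one over \<open>K x\<close> is a
        finite sum.\<close>
      also have "\<dots> = measure_pmf.expectation ?P (\<lambda>C. measure_pmf.expectation (K x)
          (\<lambda>y. - log 2 (pmf (mixture_output K M (C(w := x))) y)))"
        using x by (subst (1 2) integral_measure_pmf[of "set_pmf (K x)"])
          (auto simp: integrable_measure_pmf_finite fin)
      finally show "?h x \<le> \<dots>" .
    qed
    also have "\<dots> = measure_pmf.expectation (iid_pmf M q)
      (\<lambda>C. measure_pmf.expectation (K (C w)) (\<lambda>y. - log 2 (pmf (mixture_output K M C) y)))"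
      unfolding iid using fin by (subst expectation_bind_pmf) auto
    finally show ?thesis .
  qed
  \<comment> \<open>The bound in \<open>main\<close> is the same for every message, so it survives
    averaging over all of them.\<close>
  have "measure_pmf.expectation q ?h = (\<Sum>w<M. measure_pmf.expectation q ?h) / real M"
    using M_pos by simp
  also have "\<dots> \<le> (\<Sum>w<M. measure_pmf.expectation (iid_pmf M q)
      (\<lambda>C. measure_pmf.expectation (K (C w)) (\<lambda>y. - log 2 (pmf (mixture_output K M C) y)))) / real M"
    by (intro divide_right_mono sum_mono main) auto
  also have "\<dots> = measure_pmf.expectation (iid_pmf M q)
      (\<lambda>C. (\<Sum>w<M. measure_pmf.expectation (K (C w)) (\<lambda>y. - log 2 (pmf (mixture_output K M C) y))) / real M)"
    by (simp add: integrable_measure_pmf_finite)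
  also have "\<dots> = avg_entropy"
    unfolding pmf_entropy_def
    by (rule expectation_cong_pmf) (simp only: expectation_mixture_output)
  finally show ?thesis
    unfolding z_def .
qed

end

section \<open>Laws of large numbers and typical sequences\<close>

lemma finite_set_Pi_pmf:
  assumes "finite A" "\<And>k. k \<in> A \<Longrightarrow> finite (set_pmf (p k))"
  shows "finite (set_pmf (Pi_pmf A d p))"
  by (rule finite_subset[OF set_Pi_pmf_subset'[OF assms(1)]]) (use assms in auto)

text \<open>Independent centred variables are orthogonal, so second moments add. Splitting off one
  coordinate leaves a cross term with the factor \<open>measure_pmf.expectation (p i) (g i)\<close>,
  which is zero.\<close>

lemma second_moment_sum_Pi_pmf:
  fixes g :: "'i \<Rightarrow> 'x \<Rightarrow> real"
  assumes "finite A" "\<And>k. k \<in> A \<Longrightarrow> finite (set_pmf (p k))"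
    and "\<And>k. k \<in> A \<Longrightarrow> measure_pmf.expectation (p k) (g k) = 0"
    and "\<And>k. k \<in> A \<Longrightarrow> measure_pmf.expectation (p k) (\<lambda>x. (g k x)\<^sup>2) \<le> v"
  shows "measure_pmf.expectation (Pi_pmf A d p) (\<lambda>f. (\<Sum>k\<in>A. g k (f k))\<^sup>2) \<le> real (card A) * v"
  using assms
proof (induction A rule: finite_induct)
  case empty
  then show ?case by simp
next
  case (insert i A)
  let ?P = "Pi_pmf A d p" and ?S = "\<lambda>f. \<Sum>k\<in>A. g k (f k)"
  have fin: "finite (set_pmf ?P)" and fini: "finite (set_pmf (p i))"
    using insert by (auto intro: finite_set_Pi_pmf)
  note [simp] = integrable_measure_pmf_finite[OF fin] integrable_measure_pmf_finite[OF fini]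
  have S: "(\<Sum>k\<in>insert i A. g k ((f(i := x)) k)) = g i x + ?S f" for f x
  proof -
    have "(\<Sum>k\<in>A. g k ((f(i := x)) k)) = ?S f"
      using insert by (intro sum.cong) auto
    thus ?thesis using insert by simp
  qed
  have iid: "Pi_pmf (insert i A) d p = bind_pmf (p i) (\<lambda>x. map_pmf (\<lambda>f. f(i := x)) ?P)"
    using insert by (subst Pi_pmf_insert') (auto simp: map_pmf_def)
  have "measure_pmf.expectation (Pi_pmf (insert i A) d p) (\<lambda>f. (\<Sum>k\<in>insert i A. g k (f k))\<^sup>2)
      = measure_pmf.expectation (p i) (\<lambda>x. measure_pmf.expectation ?P
          (\<lambda>f. (\<Sum>k\<in>insert i A. g k ((f(i := x)) k))\<^sup>2))"
    unfolding iid using fin fini by (subst expectation_bind_pmf) auto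
  also have "\<dots> = measure_pmf.expectation (p i) (\<lambda>x. (g i x)\<^sup>2
      + 2 * g i x * measure_pmf.expectation ?P ?S + measure_pmf.expectation ?P (\<lambda>f. (?S f)\<^sup>2))"
    by (simp only: S power2_sum) (simp add: algebra_simps)
  also have "\<dots> = measure_pmf.expectation (p i) (\<lambda>x. (g i x)\<^sup>2)
      + 2 * measure_pmf.expectation (p i) (g i) * measure_pmf.expectation ?P ?S
      + measure_pmf.expectation ?P (\<lambda>f. (?S f)\<^sup>2)"
    by simp
  also have "\<dots> \<le> v + 0 + real (card A) * v"
    using insert by (intro add_mono) auto
  finally show ?case
    using insert by (simp add: algebra_simps)
qed

text \<open>Nonnegativity of the variance of \<bar>f\<bar>.\<close>

lemma expectation_abs_le_sqrt:
  fixes f :: "'x \<Rightarrow> real"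
  assumes fin: "finite (set_pmf p)"
  shows "measure_pmf.expectation p (\<lambda>x. \<bar>f x\<bar>) \<le> sqrt (measure_pmf.expectation p (\<lambda>x. (f x)\<^sup>2))"
proof -
  note [simp] = integrable_measure_pmf_finite[OF fin]
  have "0 \<le> measure_pmf.variance p (\<lambda>x. \<bar>f x\<bar>)"
    by (rule measure_pmf.variance_positive)
  also have "\<dots> = measure_pmf.expectation p (\<lambda>x. (f x)\<^sup>2) - (measure_pmf.expectation p (\<lambda>x. \<bar>f x\<bar>))\<^sup>2"
    by (subst measure_pmf.variance_eq) simp_all
  finally show ?thesis
    by (intro real_le_rsqrt) simp
qed

text \<open>Each centred summand is bounded by \<open>2 * c\<close>, so second moments add up to at
  most \<open>card A * (2 * c)^2\<close>, and the L1 norm is at most the L2 norm. The laws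
  \<open>p k\<close> may differ: given the input block, output letters are independent but not
  identically distributed.\<close>

lemma L1_law_of_large_numbers:
  fixes g :: "'i \<Rightarrow> 'x \<Rightarrow> real"
  assumes A: "finite A" "\<And>k. k \<in> A \<Longrightarrow> finite (set_pmf (p k))" and c: "c \<ge> 0"
    and bound: "\<And>k x. k \<in> A \<Longrightarrow> \<bar>g k x\<bar> \<le> c"
  shows "measure_pmf.expectation (Pi_pmf A d p)
      (\<lambda>f. \<bar>(\<Sum>k\<in>A. g k (f k)) - (\<Sum>k\<in>A. measure_pmf.expectation (p k) (g k))\<bar>)
    \<le> 2 * c * sqrt (real (card A))"
proof -
  let ?m = "\<lambda>k. measure_pmf.expectation (p k) (g k)"
  have m: "\<bar>?m k\<bar> \<le> c" if k: "k \<in> A" for k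
  proof -
    have "\<bar>?m k\<bar> \<le> measure_pmf.expectation (p k) (\<lambda>x. \<bar>g k x\<bar>)"
      by (rule integral_abs_bound)
    also have "\<dots> \<le> measure_pmf.expectation (p k) (\<lambda>_. c)"
      using k A bound by (intro expectation_mono_pmf) auto
    finally show ?thesis by simp
  qed
  have "measure_pmf.expectation (Pi_pmf A d p) (\<lambda>f. (\<Sum>k\<in>A. g k (f k) - ?m k)\<^sup>2)
      \<le> real (card A) * (2 * c)\<^sup>2"
  proof (rule second_moment_sum_Pi_pmf)
    fix k assume k: "k \<in> A"
    note [simp] = integrable_measure_pmf_finite[OF A(2)[OF k]]
    show "measure_pmf.expectation (p k) (\<lambda>x. g k x - ?m k) = 0" by simp
    have "measure_pmf.expectation (p k) (\<lambda>x. (g k x - ?m k)\<^sup>2)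
        \<le> measure_pmf.expectation (p k) (\<lambda>_. (2 * c)\<^sup>2)"
    proof (rule expectation_mono_pmf[OF A(2)[OF k]])
      fix x
      have "\<bar>g k x - ?m k\<bar> \<le> \<bar>2 * c\<bar>"
        using bound[OF k, of x] m[OF k] by linarith
      thus "(g k x - ?m k)\<^sup>2 \<le> (2 * c)\<^sup>2"
        by (simp only: abs_le_square_iff)
    qed
    thus "measure_pmf.expectation (p k) (\<lambda>x. (g k x - ?m k)\<^sup>2) \<le> (2 * c)\<^sup>2" by simp
  qed (use A in auto)
  hence "sqrt (measure_pmf.expectation (Pi_pmf A d p) (\<lambda>f. (\<Sum>k\<in>A. g k (f k) - ?m k)\<^sup>2))
      \<le> sqrt (real (card A) * (2 * c)\<^sup>2)"
    by (rule real_sqrt_le_mono)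
  also have "\<dots> = 2 * c * sqrt (real (card A))"
    using c by (simp only: real_sqrt_mult real_sqrt_abs) simp
  finally have "sqrt (measure_pmf.expectation (Pi_pmf A d p) (\<lambda>f. (\<Sum>k\<in>A. g k (f k) - ?m k)\<^sup>2))
      \<le> 2 * c * sqrt (real (card A))" .
  moreover have "finite (set_pmf (Pi_pmf A d p))"
    by (intro finite_set_Pi_pmf A)
  note expectation_abs_le_sqrt[OF this, of "\<lambda>f. \<Sum>k\<in>A. g k (f k) - ?m k"]
  ultimately show ?thesis by (simp add: sum_subtractf)
qed

section \<open>The law of large numbers across a memoryless channel\<close>

lemma finite_set_memoryless [simp]:
  fixes ch :: "'a \<Rightarrow> 'b::finite pmf"
  shows "finite (set_pmf (memoryless ch n x))"
  unfolding memoryless_def by (intro finite_set_Pi_pmf) auto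

lemma bind_iid_memoryless:
  "bind_pmf (iid_pmf n p) (memoryless ch n) = iid_pmf n (bind_pmf p ch)"
  unfolding iid_pmf_def memoryless_def by (subst Pi_pmf_bind[where d' = undefined]) auto

text \<open>Two stages, each contributing \<open>2 * c * sqrt n\<close>: given the input, the sum
  fluctuates around its conditional mean; that conditional mean is a sum over the iid input letters
  and fluctuates around \<open>n * \<mu>\<close>.\<close>

lemma L1_law_of_large_numbers_channel:
  fixes p0 :: "'a::finite pmf" and ch :: "'a \<Rightarrow> 'b::finite pmf" and g :: "'a \<Rightarrow> 'b \<Rightarrow> real"
  assumes bound: "\<And>a b. \<bar>g a b\<bar> \<le> c"
  defines "\<mu> \<equiv> measure_pmf.expectation p0 (\<lambda>a. measure_pmf.expectation (ch a) (g a))"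
  shows "measure_pmf.expectation (iid_pmf n p0) (\<lambda>x. measure_pmf.expectation (memoryless ch n x)
      (\<lambda>y. \<bar>(\<Sum>k<n. g (x k) (y k)) - real n * \<mu>\<bar>)) \<le> 4 * c * sqrt (real n)"
proof -
  let ?m = "\<lambda>a. measure_pmf.expectation (ch a) (g a)"
  have c: "c \<ge> 0"
    using bound[of undefined undefined] by linarith
  have m: "\<bar>?m a\<bar> \<le> c" for a
  proof -
    have "\<bar>?m a\<bar> \<le> measure_pmf.expectation (ch a) (\<lambda>x. \<bar>g a x\<bar>)"
      by (rule integral_abs_bound)
    also have "\<dots> \<le> measure_pmf.expectation (ch a) (\<lambda>_. c)"
      using bound by (intro expectation_mono_pmf) auto
    finally show ?thesis by simp
  qed
  have "measure_pmf.expectation (iid_pmf n p0) (\<lambda>x. measure_pmf.expectation (memoryless ch n x)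
      (\<lambda>y. \<bar>(\<Sum>k<n. g (x k) (y k)) - real n * \<mu>\<bar>))
    \<le> measure_pmf.expectation (iid_pmf n p0) (\<lambda>x. 2 * c * sqrt (real n) + \<bar>(\<Sum>k<n. ?m (x k)) - real n * \<mu>\<bar>)"
  proof (rule expectation_mono_pmf)
    fix x
    note [simp] = integrable_measure_pmf_finite[OF finite_set_memoryless]
    have "measure_pmf.expectation (memoryless ch n x) (\<lambda>y. \<bar>(\<Sum>k<n. g (x k) (y k)) - real n * \<mu>\<bar>)
      \<le> measure_pmf.expectation (memoryless ch n x) (\<lambda>y. \<bar>(\<Sum>k<n. g (x k) (y k)) - (\<Sum>k<n. ?m (x k))\<bar>
          + \<bar>(\<Sum>k<n. ?m (x k)) - real n * \<mu>\<bar>)"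
      by (intro expectation_mono_pmf) auto
    also have "\<dots> = measure_pmf.expectation (memoryless ch n x)
          (\<lambda>y. \<bar>(\<Sum>k<n. g (x k) (y k)) - (\<Sum>k<n. ?m (x k))\<bar>) + \<bar>(\<Sum>k<n. ?m (x k)) - real n * \<mu>\<bar>"
      by simp
    also have "measure_pmf.expectation (memoryless ch n x)
          (\<lambda>y. \<bar>(\<Sum>k<n. g (x k) (y k)) - (\<Sum>k<n. ?m (x k))\<bar>) \<le> 2 * c * sqrt (real n)"
      using L1_law_of_large_numbers[of "{..<n}" "\<lambda>k. ch (x k)" c "\<lambda>k. g (x k)" undefined] c bound
      by (simp add: memoryless_def)
    finally show "measure_pmf.expectation (memoryless ch n x) (\<lambda>y. \<bar>(\<Sum>k<n. g (x k) (y k)) - real n * \<mu>\<bar>)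
      \<le> 2 * c * sqrt (real n) + \<bar>(\<Sum>k<n. ?m (x k)) - real n * \<mu>\<bar>" by simp
  qed simp
  also have "\<dots> = 2 * c * sqrt (real n)
      + measure_pmf.expectation (iid_pmf n p0) (\<lambda>x. \<bar>(\<Sum>k<n. ?m (x k)) - real n * \<mu>\<bar>)"
    by (simp add: integrable_measure_pmf_finite)
  also have "\<dots> \<le> 2 * c * sqrt (real n) + 2 * c * sqrt (real n)"
    using L1_law_of_large_numbers[of "{..<n}" "\<lambda>_. p0" c "\<lambda>_. ?m" undefined] c m
    by (simp add: iid_pmf_def \<mu>_def)
  finally show ?thesis by simp
qed

text \<open>Markov's inequality: outside the typical set some letter count misses its mean by at
  least \<open>\<epsilon> * n / CARD('a)\<close>, while the sum of all these deviations has mean of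
  order \<open>sqrt n\<close>.\<close>

lemma prob_not_strongly_typical_le:
  fixes p0 :: "'a::finite pmf"
  assumes "\<epsilon> > 0" "n > 0"
  shows "1 - measure_pmf.prob (iid_pmf n p0) (strongly_typical p0 \<epsilon> n)
    \<le> 2 * (real CARD('a))\<^sup>2 / \<epsilon> / sqrt (real n)"
proof -
  let ?P = "iid_pmf n p0" and ?T = "strongly_typical p0 \<epsilon> n" and ?N = "real CARD('a)"
  let ?dev = "\<lambda>a x. \<bar>(\<Sum>k<n. indicator {a} (x k)) - real n * pmf p0 a\<bar>"
  have "1 - measure_pmf.prob ?P ?T = measure_pmf.prob ?P (- ?T)"
    using measure_pmf.prob_compl[of ?T ?P] by (simp add: Compl_eq_Diff_UNIV)
  also have "\<dots> = measure_pmf.expectation ?P (indicator (- ?T))"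
    by simp
  also have "\<dots> \<le> measure_pmf.expectation ?P (\<lambda>x. (\<Sum>a\<in>UNIV. ?dev a x) * (?N / (\<epsilon> * n)))"
  proof (rule expectation_mono_pmf)
    fix x assume x: "x \<in> set_pmf ?P"
    have ext: "x \<in> {..<n} \<rightarrow>\<^sub>E UNIV" and supp: "\<And>k. k < n \<Longrightarrow> pmf p0 (x k) > 0"
      using x by (auto simp: iid_pmf_def set_Pi_pmf PiE_dflt_def extensional_def pmf_positive_iff)
    have occ: "real (occurrences n a x) = (\<Sum>k<n. indicator {a} (x k))" for a
      unfolding occurrences_def
      by (simp add: indicator_def sum.If_cases Int_def)
    show "indicator (- ?T) x \<le> (\<Sum>a\<in>UNIV. ?dev a x) * (?N / (\<epsilon> * n))"
    proof (cases "x \<in> ?T")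
      case True
      then show ?thesis using assms by (auto intro!: mult_nonneg_nonneg sum_nonneg)
    next
      case False
      \<comment> \<open>Letters of probability zero do not occur on the support, so an atypical
        block there must violate a frequency condition.\<close>
      have zero: "occurrences n a x = 0" if "pmf p0 a = 0" for a
        using that supp by (force simp: occurrences_def)
      from False ext zero obtain a where "\<not> \<bar>real (occurrences n a x) / real n - pmf p0 a\<bar> < \<epsilon> / ?N"
        by (auto simp: strongly_typical_def)
      hence "\<epsilon> / ?N * n \<le> \<bar>real (occurrences n a x) / real n - pmf p0 a\<bar> * n"
        by (intro mult_right_mono) auto
      also have "\<dots> = \<bar>(real (occurrences n a x) / real n - pmf p0 a) * n\<bar>"
        by (simp add: abs_mult)
      also have "(real (occurrences n a x) / real n - pmf p0 a) * n = real (occurrences n a x) - real n * pmf p0 a"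
        using assms by (simp add: field_simps)
      also have "\<bar>\<dots>\<bar> = ?dev a x"
        by (simp add: occ)
      also have "\<dots> \<le> (\<Sum>a\<in>UNIV. ?dev a x)"
        by (rule member_le_sum) auto
      finally have "\<epsilon> / ?N * n * (?N / (\<epsilon> * n)) \<le> (\<Sum>a\<in>UNIV. ?dev a x) * (?N / (\<epsilon> * n))"
        using assms by (intro mult_right_mono) auto
      moreover have "\<epsilon> / ?N * n * (?N / (\<epsilon> * n)) = 1"
        using assms by simp
      ultimately show ?thesis using False by simp
    qed
  qed simp
  also have "\<dots> = (\<Sum>a\<in>UNIV. measure_pmf.expectation ?P (?dev a)) * (?N / (\<epsilon> * n))"
    by (simp add: integrable_measure_pmf_finite)
  also have "\<dots> \<le> (\<Sum>a\<in>(UNIV::'a set). 2 * sqrt (real n)) * (?N / (\<epsilon> * n))"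
  proof (intro mult_right_mono sum_mono)
    fix a
    \<comment> \<open>The law of large numbers for an indicator function, which is bounded by
      1.\<close>
    show "measure_pmf.expectation ?P (?dev a) \<le> 2 * sqrt (real n)"
      using L1_law_of_large_numbers[of "{..<n}" "\<lambda>_. p0" 1 "\<lambda>_. indicator {a}" undefined]
      by (simp add: iid_pmf_def measure_pmf_single)
  qed (use assms in auto)
  also have "\<dots> = 2 * ?N\<^sup>2 / \<epsilon> * (sqrt (real n) / real n)"
    by (simp add: power2_eq_square)
  also have "sqrt (real n) / real n = 1 / sqrt (real n)"
    by (simp add: sqrt_divide_self_eq inverse_eq_divide)
  finally show ?thesis by simp
qed

lemma eventually_prob_strongly_typical_ge:
  fixes p0 :: "'a::finite pmf"
  assumes "\<epsilon> > 0"
  shows "\<forall>\<^sub>F n in sequentially. measure_pmf.prob (iid_pmf n p0) (strongly_typical p0 \<epsilon> n) \<ge> 1 / 2"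
proof -
  let ?f = "\<lambda>n. 2 * (real CARD('a))\<^sup>2 / \<epsilon> / sqrt (real n)"
  have "?f \<longlonglongrightarrow> 0"
    by (intro tendsto_divide_0[OF tendsto_const] filterlim_at_top_imp_at_infinity
        filterlim_compose[OF sqrt_at_top] filterlim_real_sequentially)
  hence "\<forall>\<^sub>F n in sequentially. ?f n < 1 / 2"
    by (rule order_tendstoD) simp
  thus ?thesis
    using eventually_gt_at_top[of 0]
  proof eventually_elim
    case (elim n)
    with prob_not_strongly_typical_le[OF assms, of n p0] show ?case by linarith
  qed
qed

section \<open>Transmission with typical codewords\<close>

text \<open>Disintegration: the conditioning event has probability \<open>pmf p c\<close>, which
  cancels and leaves the kernel at \<open>c\<close>.\<close>

lemma cond_joint_pmf_fst:
  assumes "c \<in> set_pmf p"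
  shows "cond_pmf (joint_pmf p L) {s. fst s = c} = map_pmf (Pair c) (L c)"
proof (rule pmf_eqI)
  fix s :: "'a \<times> 'b"
  obtain a b where s: "s = (a, b)" by (cases s)
  have ne: "set_pmf (joint_pmf p L) \<inter> {s. fst s = c} \<noteq> {}"
    using assms set_pmf_not_empty[of "L c"] by (fastforce simp: joint_pmf_def)
  have "measure_pmf.prob (joint_pmf p L) {s. fst s = c} = measure_pmf.prob (map_pmf fst (joint_pmf p L)) {c}"
    by (simp add: vimage_def)
  also have "\<dots> = pmf p c"
    by (simp only: map_fst_joint_pmf measure_pmf_single)
  finally have "pmf (cond_pmf (joint_pmf p L) {s. fst s = c}) s = (if a = c then pmf (L a) b else 0)"
    using assms by (simp add: pmf_cond[OF ne] s pmf_joint_pmf pmf_eq_0_set_pmf)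
  also have "\<dots> = pmf (map_pmf (Pair c) (L c)) s"
    by (auto simp: s pmf_map_inj' inj_on_def pmf_eq_0_set_pmf)
  finally show "pmf (cond_pmf (joint_pmf p L) {s. fst s = c}) s = pmf (map_pmf (Pair c) (L c)) s" .
qed

lemma num_messages_pos: "num_messages R n > 0"
  unfolding num_messages_def by (simp add: zero_less_ceiling)

lemma log_num_messages:
  assumes "R > 0"
  shows "real n * R \<le> log 2 (num_messages R n)" "log 2 (num_messages R n) \<le> real n * R + 1"
proof -
  let ?x = "2 powr (real n * R)"
  have x: "1 \<le> ?x"
    using assms by (simp add: ge_one_powr_ge_zero)
  \<comment> \<open>Since \<open>?x\<close> is at least 1, rounding up at most doubles it, which
    costs one bit.\<close>
  have M: "?x \<le> num_messages R n" "num_messages R n \<le> ?x * 2"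
    unfolding num_messages_def using x by linarith+
  have "log 2 ?x \<le> log 2 (num_messages R n)"
    using M x by (intro log_mono) auto
  thus "real n * R \<le> log 2 (num_messages R n)" by simp
  have "log 2 (num_messages R n) \<le> log 2 (?x * 2)"
    using M x by (intro log_mono) (use num_messages_pos in auto)
  also have "\<dots> = real n * R + 1"
    by (subst log_mult) auto
  finally show "log 2 (num_messages R n) \<le> real n * R + 1" .
qed

text \<open>Message and codebook are independent and can be drawn in either order; for any fixed
  message the codeword has law \<open>codeword_pmf p0 \<epsilon> n\<close>. Hence the rate
  disappears from the unconditional output law.\<close>

lemma map_output_block_transmission_pmf:
  "map_pmf output_block (transmission_pmf p0 ch \<epsilon> R n)
    = bind_pmf (codeword_pmf p0 \<epsilon> n) (memoryless ch n)"
proof -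
  let ?q = "codeword_pmf p0 \<epsilon> n" and ?M = "num_messages R n"
  have ne: "{..<?M} \<noteq> {}"
    using num_messages_pos[of R n] by auto
  have "map_pmf output_block (transmission_pmf p0 ch \<epsilon> R n)
      = bind_pmf (codebook_pmf p0 \<epsilon> R n) (\<lambda>C. bind_pmf (pmf_of_set {..<?M}) (\<lambda>w. memoryless ch n (C w)))"
    by (simp add: transmission_pmf_def map_bind_pmf output_block_def bind_return_pmf')
  also have "\<dots> = bind_pmf (pmf_of_set {..<?M}) (\<lambda>w. bind_pmf (codebook_pmf p0 \<epsilon> R n) (\<lambda>C. memoryless ch n (C w)))"
    by (rule bind_commute_pmf)
  also have "\<dots> = bind_pmf (pmf_of_set {..<?M}) (\<lambda>w. bind_pmf ?q (memoryless ch n))"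
  proof (rule bind_pmf_cong[OF refl])
    fix w assume "w \<in> set_pmf (pmf_of_set {..<?M})"
    hence w: "w < ?M" using ne by simp
    have "bind_pmf (codebook_pmf p0 \<epsilon> R n) (\<lambda>C. memoryless ch n (C w))
        = bind_pmf (map_pmf (\<lambda>C. C w) (codebook_pmf p0 \<epsilon> R n)) (memoryless ch n)"
      by (simp add: bind_map_pmf)
    also have "map_pmf (\<lambda>C. C w) (codebook_pmf p0 \<epsilon> R n) = ?q"
      using w by (simp add: codebook_pmf_def iid_pmf_def Pi_pmf_component)
    finally show "bind_pmf (codebook_pmf p0 \<epsilon> R n) (\<lambda>C. memoryless ch n (C w))
        = bind_pmf ?q (memoryless ch n)" .
  qed
  finally show ?thesis by simp
qed

text \<open>Exhibits the codebook as the first component of a joint law, so that conditioning on it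
  becomes evaluation of a kernel.\<close>

lemma transmission_pmf_eq_joint_pmf:
  "transmission_pmf p0 ch \<epsilon> R n = joint_pmf (codebook_pmf p0 \<epsilon> R n)
    (\<lambda>C. bind_pmf (pmf_of_set {..<num_messages R n}) (\<lambda>w. map_pmf (Pair w) (memoryless ch n (C w))))"
  by (simp add: transmission_pmf_def joint_pmf_def map_pmf_def bind_assoc_pmf bind_return_pmf)

lemma avg_conditional_entropy2_transmission_pmf:
  fixes ch :: "'a::finite \<Rightarrow> 'b::finite pmf"
  assumes fin: "finite (set_pmf (codeword_pmf p0 \<epsilon> n))"
  shows "avg_conditional_entropy2 (transmission_pmf p0 ch \<epsilon> R n) output_block codebook
    = measure_pmf.expectation (codebook_pmf p0 \<epsilon> R n)
        (\<lambda>C. pmf_entropy (mixture_output (memoryless ch n) (num_messages R n) C))"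
proof -
  let ?B = "codebook_pmf p0 \<epsilon> R n" and ?P = "transmission_pmf p0 ch \<epsilon> R n"
  let ?mix = "mixture_output (memoryless ch n) (num_messages R n)"
  have cb: "codebook = fst"
    by (auto simp: codebook_def)
  have ob: "output_block = snd \<circ> snd"
    by (auto simp: output_block_def)
  have finB: "finite (set_pmf ?B)"
    using fin by (simp add: codebook_pmf_def)
  have ne: "{..<num_messages R n} \<noteq> {}"
    using num_messages_pos[of R n] by auto
  have map: "map_pmf codebook ?P = ?B"
    unfolding cb transmission_pmf_eq_joint_pmf by (rule map_fst_joint_pmf)
  have prob: "measure_pmf.prob ?P {s. codebook s = C} = pmf ?B C" for C
  proof -
    have "measure_pmf.prob ?P {s. codebook s = C} = measure_pmf.prob (map_pmf codebook ?P) {C}"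
      by (simp add: vimage_def)
    thus ?thesis by (simp only: map measure_pmf_single)
  qed
  have ent: "entropy2 (cond_pmf ?P {s. codebook s = C}) output_block = pmf_entropy (?mix C)"
    if "C \<in> set_pmf ?B" for C
  proof -
    have "map_pmf output_block (cond_pmf ?P {s. codebook s = C}) = ?mix C"
      unfolding cb transmission_pmf_eq_joint_pmf cond_joint_pmf_fst[OF that]
      by (simp add: ob mixture_output_def pmf.map_comp map_bind_pmf o_def)
    moreover have "finite (set_pmf (?mix C))"
      using ne by (simp add: mixture_output_def)
    ultimately show ?thesis
      by (simp only: entropy2_eq_pmf_entropy)
  qed
  show ?thesis
    unfolding avg_conditional_entropy2_def map
    by (subst integral_measure_pmf[OF finB]) (auto simp: prob ent intro!: sum.cong)
qed

text \<open>On the support all factors are positive, so the logarithm turns the product into a sum,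
  to which the laws of large numbers apply.\<close>

lemma log_pmf_Pi_pmf:
  assumes "finite A" "y \<in> set_pmf (Pi_pmf A d p)"
  shows "log 2 (pmf (Pi_pmf A d p) y) = (\<Sum>k\<in>A. log 2 (pmf (p k) (y k)))"
proof -
  have y: "y \<in> PiE_dflt A d (set_pmf \<circ> p)"
    using assms by (simp add: set_Pi_pmf)
  hence "pmf (Pi_pmf A d p) y = (\<Prod>k\<in>A. pmf (p k) (y k))"
    using assms(1) by (intro pmf_Pi') (auto simp: PiE_dflt_def)
  moreover have "ln (\<Prod>k\<in>A. pmf (p k) (y k)) = (\<Sum>k\<in>A. ln (pmf (p k) (y k)))"
    using y assms(1) by (intro ln_prod) (auto simp: PiE_dflt_def set_pmf_iff)
  ultimately show ?thesis
    by (simp add: log_def sum_divide_distrib)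
qed

text \<open>Fixes one block length at which typicality has probability at least 1/2, together with a
  common bound \<open>c\<close> on the single-letter information densities. All error terms below
  are explicit in \<open>c\<close> and \<open>n\<close>.\<close>

locale typical_transmission =
  fixes p0 :: "'a::finite pmf" and ch :: "'a \<Rightarrow> 'b::finite pmf" and \<epsilon> R c :: real and n :: nat
  assumes R_pos: "R > 0"
    and typical: "measure_pmf.prob (iid_pmf n p0) (strongly_typical p0 \<epsilon> n) \<ge> 1 / 2"
    and n_pos: "n > 0"
    and bound_channel: "\<And>a b. \<bar>- log 2 (pmf (ch a) b)\<bar> \<le> c"
    and bound_output: "\<And>b. \<bar>- log 2 (pmf (bind_pmf p0 ch) b)\<bar> \<le> c"
begin

abbreviation "q \<equiv> codeword_pmf p0 \<epsilon> n"
abbreviation "K \<equiv> memoryless ch n"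
abbreviation "r \<equiv> iid_pmf n (bind_pmf p0 ch)"
abbreviation "M \<equiv> num_messages R n"
abbreviation "channel_entropy \<equiv> measure_pmf.expectation p0 (\<lambda>a. pmf_entropy (ch a))"
abbreviation "output_entropy \<equiv> pmf_entropy (bind_pmf p0 ch)"
abbreviation "channel_info x y \<equiv> - log 2 (pmf (K x) y)"
abbreviation "output_info y \<equiv> - log 2 (pmf r y)"
abbreviation mean :: "((nat \<Rightarrow> 'a) \<Rightarrow> (nat \<Rightarrow> 'b) \<Rightarrow> real) \<Rightarrow> real" where
  "mean f \<equiv> measure_pmf.expectation q (\<lambda>x. measure_pmf.expectation (K x) (f x))"

section \<open>Comparing typical codewords with iid blocks\<close>

lemma typical_nonempty: "set_pmf (iid_pmf n p0) \<inter> strongly_typical p0 \<epsilon> n \<noteq> {}"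
proof
  assume "set_pmf (iid_pmf n p0) \<inter> strongly_typical p0 \<epsilon> n = {}"
  hence "measure_pmf.prob (iid_pmf n p0) (strongly_typical p0 \<epsilon> n) = 0"
    by (simp add: measure_pmf_zero_iff)
  thus False using typical by simp
qed

lemma set_q: "set_pmf q \<subseteq> set_pmf (iid_pmf n p0)"
  unfolding codeword_pmf_def by (simp add: set_cond_pmf[OF typical_nonempty])

lemma finite_q [simp]: "finite (set_pmf q)"
  by (rule finite_subset[OF set_q]) simp

lemma pmf_q_le: "pmf q x \<le> 2 * pmf (iid_pmf n p0) x"
proof -
  let ?t = "measure_pmf.prob (iid_pmf n p0) (strongly_typical p0 \<epsilon> n)"
  have "pmf (iid_pmf n p0) x / ?t \<le> pmf (iid_pmf n p0) x / (1 / 2)"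
    using typical by (intro divide_left_mono) auto
  thus ?thesis
    unfolding codeword_pmf_def by (simp add: pmf_cond[OF typical_nonempty])
qed

lemma expectation_q_le:
  fixes h :: "(nat \<Rightarrow> 'a) \<Rightarrow> real"
  assumes "\<And>x. h x \<ge> 0"
  shows "measure_pmf.expectation q h \<le> 2 * measure_pmf.expectation (iid_pmf n p0) h"
proof -
  let ?S = "set_pmf (iid_pmf n p0)"
  have "measure_pmf.expectation q h = (\<Sum>x\<in>?S. pmf q x * h x)"
    using set_q by (subst integral_measure_pmf[of ?S]) auto
  also have "\<dots> \<le> (\<Sum>x\<in>?S. 2 * pmf (iid_pmf n p0) x * h x)"
    using assms by (intro sum_mono mult_right_mono pmf_q_le)
  also have "\<dots> = 2 * measure_pmf.expectation (iid_pmf n p0) h"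
    by (subst integral_measure_pmf[of ?S]) (auto simp: sum_distrib_left mult.assoc)
  finally show ?thesis .
qed

text \<open>The one-shot bounds are applied with whole blocks as symbols.\<close>

sublocale random_code q K M
  by unfold_locales (simp_all add: num_messages_pos)

lemma set_output: "set_pmf (bind_pmf q K) \<subseteq> set_pmf r"
  using set_q unfolding bind_iid_memoryless[symmetric] by auto

lemma pmf_output_le: "pmf (bind_pmf q K) y \<le> 2 * pmf r y"
  unfolding bind_iid_memoryless[symmetric] pmf_bind by (rule expectation_q_le) simp

section \<open>Concentration of the information densities\<close>

lemma mean_mono:
  assumes "\<And>x y. x \<in> set_pmf q \<Longrightarrow> y \<in> set_pmf (K x) \<Longrightarrow> f x y \<le> g x y"
  shows "mean f \<le> mean g"
  using assms by (intro expectation_mono_pmf) auto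

lemma mean_add: "mean (\<lambda>x y. f x y + g x y) = mean f + mean g"
  by (simp add: integrable_measure_pmf_finite)

lemma mean_diff: "mean (\<lambda>x y. f x y - g x y) = mean f - mean g"
  by (simp add: integrable_measure_pmf_finite)

lemma mean_const: "mean (\<lambda>x y. t) = t"
  by simp

lemma abs_mean_le: "\<bar>mean f\<bar> \<le> mean (\<lambda>x y. \<bar>f x y\<bar>)"
  by (rule order_trans[OF integral_abs_bound])
    (intro expectation_mono_pmf integral_abs_bound finite_q)

text \<open>The constant 8 is the 4 of the law of large numbers for iid inputs times the 2 from
  \<open>expectation_q_le\<close>. Agreement of \<open>f\<close> with the sum is asked only on the
  support, where the logarithm of the product splits.\<close>

lemma mean_deviation_le:
  assumes "\<And>a b. \<bar>g a b\<bar> \<le> c"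
    and "\<And>x y. x \<in> set_pmf q \<Longrightarrow> y \<in> set_pmf (K x) \<Longrightarrow> f x y = (\<Sum>k<n. g (x k) (y k))"
  shows "mean (\<lambda>x y. \<bar>f x y - real n * measure_pmf.expectation p0 (\<lambda>a. measure_pmf.expectation (ch a) (g a))\<bar>)
    \<le> 8 * c * sqrt (real n)"
proof -
  let ?h = "\<lambda>x y. \<bar>(\<Sum>k<n. g (x k) (y k))
    - real n * measure_pmf.expectation p0 (\<lambda>a. measure_pmf.expectation (ch a) (g a))\<bar>"
  have "mean (\<lambda>x y. \<bar>f x y - real n * measure_pmf.expectation p0 (\<lambda>a. measure_pmf.expectation (ch a) (g a))\<bar>)
    \<le> mean ?h"
    using assms(2) by (intro mean_mono) simp
  also have "\<dots> \<le> 2 * measure_pmf.expectation (iid_pmf n p0) (\<lambda>x. measure_pmf.expectation (K x) (?h x))"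
    by (intro expectation_q_le Bochner_Integration.integral_nonneg) simp
  also have "\<dots> \<le> 2 * (4 * c * sqrt (real n))"
    by (intro mult_left_mono L1_law_of_large_numbers_channel assms) simp
  finally show ?thesis by simp
qed

lemma channel_deviation:
  "mean (\<lambda>x y. \<bar>channel_info x y - real n * channel_entropy\<bar>) \<le> 8 * c * sqrt (real n)"
  unfolding pmf_entropy_def
  by (intro mean_deviation_le bound_channel)
    (simp add: memoryless_def log_pmf_Pi_pmf sum_negf)

lemma output_deviation:
  "mean (\<lambda>x y. \<bar>output_info y - real n * output_entropy\<bar>) \<le> 8 * c * sqrt (real n)"
proof -
  \<comment> \<open>Written as a two-stage mean, the output entropy fits
    \<open>mean_deviation_le\<close> with a \<open>g\<close> that ignores the input letter.\<close>
  have *: "output_entropy = measure_pmf.expectation p0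
      (\<lambda>a. measure_pmf.expectation (ch a) (\<lambda>b. - log 2 (pmf (bind_pmf p0 ch) b)))"
    unfolding pmf_entropy_def by (rule expectation_bind_pmf) auto
  show ?thesis unfolding *
  proof (intro mean_deviation_le bound_output)
    fix x y assume "x \<in> set_pmf q" "y \<in> set_pmf (K x)"
    hence "y \<in> set_pmf r" using set_output by auto
    thus "output_info y = (\<Sum>k<n. - log 2 (pmf (bind_pmf p0 ch) (y k)))"
      by (simp add: iid_pmf_def log_pmf_Pi_pmf sum_negf)
  qed
qed

lemma mean_le_of_deviation:
  assumes "mean (\<lambda>x y. \<bar>f x y - m\<bar>) \<le> d"
  shows "\<bar>mean f - m\<bar> \<le> d"
proof -
  have "mean f - m = mean (\<lambda>x y. f x y - m)"
    by (simp only: mean_diff mean_const)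
  also have "\<bar>\<dots>\<bar> \<le> d"
    using abs_mean_le[of "\<lambda>x y. f x y - m"] assms by linarith
  finally show ?thesis .
qed

lemma c_nonneg: "c \<ge> 0"
  using bound_output[of undefined] by linarith

lemma sqrt_n_ge_1: "sqrt (real n) \<ge> 1"
  using n_pos by simp

text \<open>Both bounds compare with the product law \<open>r\<close>: Gibbs' inequality from above,
  and from below the domination by \<open>2 * pmf r y\<close>, which loses one bit. That bit is
  absorbed by \<open>sqrt n\<close>.\<close>

lemma output_entropy_deviation:
  "\<bar>pmf_entropy (bind_pmf q K) - real n * output_entropy\<bar> \<le> (8 * c + 1) * sqrt (real n)"
proof -
  have E: "measure_pmf.expectation (bind_pmf q K) h = mean (\<lambda>_. h)" for h :: "_ \<Rightarrow> real"
    by (rule expectation_bind_pmf) simp_all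
  have "pmf_entropy (bind_pmf q K) \<le> mean (\<lambda>_. output_info)"
    using gibbs_inequality[of "bind_pmf q K" r] set_output by (simp add: E)
  moreover have "mean (\<lambda>x y. output_info y - 1) \<le> pmf_entropy (bind_pmf q K)"
    unfolding pmf_entropy_def E
  proof (rule mean_mono)
    fix x y assume "x \<in> set_pmf q" "y \<in> set_pmf (K x)"
    hence y: "y \<in> set_pmf (bind_pmf q K)" by auto
    hence pos: "pmf (bind_pmf q K) y > 0" "pmf r y > 0"
      using set_output by (auto simp only: pmf_positive_iff)
    have "log 2 (pmf (bind_pmf q K) y) \<le> log 2 (2 * pmf r y)"
      using pos pmf_output_le by (intro log_mono) auto
    thus "output_info y - 1 \<le> - log 2 (pmf (bind_pmf q K) y)"
      using pos by (simp add: log_mult)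
  qed
  hence "mean (\<lambda>_. output_info) - 1 \<le> pmf_entropy (bind_pmf q K)"
    by (simp only: mean_diff mean_const)
  moreover note mean_le_of_deviation[OF output_deviation]
  moreover have "(8 * c + 1) * sqrt (real n) = 8 * c * sqrt (real n) + sqrt (real n)"
    by (simp add: algebra_simps)
  ultimately show ?thesis
    using sqrt_n_ge_1 by linarith
qed

lemma avg_entropy_deviation:
  "\<bar>avg_entropy - real n * min (R + channel_entropy) output_entropy\<bar> \<le> (16 * c + 2) * sqrt (real n)"
proof -
  let ?A = "log 2 M + real n * channel_entropy" and ?B = "real n * output_entropy"
  let ?d = "8 * c * sqrt (real n)"
  have M: "real n * R \<le> log 2 M" "log 2 M \<le> real n * R + 1"
    using log_num_messages[OF R_pos] by auto
  have d: "?d \<ge> 0" using c_nonneg by simp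
  have "avg_entropy \<le> mean (\<lambda>_. output_info)"
    using avg_entropy_le_cross_entropy[OF set_output]
    by (subst (asm) expectation_bind_pmf) simp_all
  hence upB: "avg_entropy \<le> ?B + ?d"
    using mean_le_of_deviation[OF output_deviation] by linarith
  have "avg_entropy \<le> log 2 M + mean channel_info"
    using avg_entropy_le_rate unfolding pmf_entropy_def[of "K _"] .
  hence upA: "avg_entropy \<le> ?A + ?d"
    using mean_le_of_deviation[OF channel_deviation] by linarith
  \<comment> \<open>Pointwise, the smaller information density is at least the smaller of the two
    centres minus both deviations; in this form averaging is linear and each deviation is controlled
    separately.\<close>
  have "mean (\<lambda>x y. (min ?A ?B - 2) - (\<bar>channel_info x y - real n * channel_entropy\<bar>
      + \<bar>output_info y - real n * output_entropy\<bar>))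
    \<le> mean (\<lambda>x y. - log 2 (pmf (K x) y / real M + pmf (bind_pmf q K) y))"
  proof (rule mean_mono)
    fix x y assume x: "x \<in> set_pmf q" and y: "y \<in> set_pmf (K x)"
    hence "y \<in> set_pmf r" using set_output by auto
    hence pos: "pmf (K x) y > 0" "pmf r y > 0" "real M > 0"
      using y M_pos by (auto simp: pmf_positive_iff)
    let ?u = "pmf (K x) y / real M" and ?v = "2 * pmf r y"
    have uv: "?u > 0" "?v > 0" using pos by auto
    \<comment> \<open>The loss of 2 bits arises here: one from bounding a sum by twice the maximum,
      one from the factor 2 in \<open>?v\<close>.\<close>
    have "log 2 (?u + pmf (bind_pmf q K) y) \<le> log 2 (2 * max ?u ?v)"
      using uv pmf_output_le[of y] by (intro log_mono) (auto intro: add_pos_nonneg)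
    also have "\<dots> = 1 + max (log 2 ?u) (log 2 ?v)"
      using uv by (subst log_mult) (auto simp: max_def)
    also have "log 2 ?u = - log 2 M - channel_info x y"
      using pos by (simp add: log_divide)
    also have "log 2 ?v = 1 - output_info y"
      using pos by (simp add: log_mult)
    finally show "(min ?A ?B - 2) - (\<bar>channel_info x y - real n * channel_entropy\<bar>
        + \<bar>output_info y - real n * output_entropy\<bar>)
      \<le> - log 2 (?u + pmf (bind_pmf q K) y)"
      by linarith
  qed
  also have "\<dots> \<le> avg_entropy"
    by (rule avg_entropy_ge)
  finally have "min ?A ?B - 2 - (?d + ?d) \<le> avg_entropy"
    using channel_deviation output_deviation unfolding mean_diff mean_add mean_const by linarith
  moreover have "real n * min (R + channel_entropy) output_entropy
      = min (real n * R + real n * channel_entropy) ?B"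
    by (simp add: min_mult_distrib_left distrib_left)
  \<comment> \<open>Replacing \<open>log 2 M\<close> by \<open>n * R\<close> is harmless for the
    lower bound and costs one bit in the upper bound.\<close>
  ultimately have "\<bar>avg_entropy - real n * min (R + channel_entropy) output_entropy\<bar> \<le> ?d + ?d + 2"
    using upA upB M d by linarith
  also have "\<dots> \<le> (16 * c + 2) * sqrt (real n)"
    using sqrt_n_ge_1 by (simp add: algebra_simps)
  finally show ?thesis .
qed

end

section \<open>Passage to the limit\<close>

lemma tendsto_rate_of_sqrt_deviation:
  fixes h :: "nat \<Rightarrow> real"
  assumes "\<forall>\<^sub>F n in sequentially. \<bar>h n - real n * l\<bar> \<le> d * sqrt (real n)"
  shows "(\<lambda>n. h n / real n) \<longlonglongrightarrow> l"
proof (rule LIM_zero_cancel, rule Lim_null_comparison)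
  show "(\<lambda>n. d / sqrt (real n)) \<longlonglongrightarrow> 0"
    by (intro tendsto_divide_0[OF tendsto_const] filterlim_at_top_imp_at_infinity
        filterlim_compose[OF sqrt_at_top] filterlim_real_sequentially)
  show "\<forall>\<^sub>F n in sequentially. norm (h n / real n - l) \<le> d / sqrt (real n)"
    using assms eventually_gt_at_top[of 0]
  proof eventually_elim
    case (elim n)
    have "norm (h n / real n - l) = \<bar>h n - real n * l\<bar> / real n"
      using elim(2) by (simp add: abs_divide[symmetric] field_simps)
    also have "\<dots> \<le> d * sqrt (real n) / real n"
      using elim by (intro divide_right_mono) auto
    also have "\<dots> = d / sqrt (real n)"
      unfolding times_divide_eq_right[symmetric] sqrt_divide_self_eq[OF of_nat_0_le_iff]
      by (simp add: divide_inverse)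
    finally show ?case .
  qed
qed

theorem mainTheorem3:
  fixes p0 :: "'a::finite pmf" and ch :: "'a \<Rightarrow> 'b::finite pmf" and \<epsilon> R :: real
  assumes "\<epsilon> > 0" and "R > 0"
  shows
    "(R > mutual_information2 (joint_pmf p0 ch) fst snd \<longrightarrow>
        (\<lambda>n. avg_conditional_entropy2 (transmission_pmf p0 ch \<epsilon> R n) output_block codebook / real n)
          \<longlonglongrightarrow> entropy2 (joint_pmf p0 ch) snd) \<and>
     (R < mutual_information2 (joint_pmf p0 ch) fst snd \<longrightarrow>
        (\<lambda>n. avg_conditional_entropy2 (transmission_pmf p0 ch \<epsilon> R n) output_block codebook / real n)
          \<longlonglongrightarrow> R + conditional_entropy2 (joint_pmf p0 ch) snd fst) \<and>
     (\<lambda>n. entropy2 (transmission_pmf p0 ch \<epsilon> R n) output_block / real n)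
        \<longlonglongrightarrow> entropy2 (joint_pmf p0 ch) snd"
proof -
  define a where "a = measure_pmf.expectation p0 (\<lambda>a. pmf_entropy (ch a))"
  define b where "b = pmf_entropy (bind_pmf p0 ch)"
  \<comment> \<open>A maximum over finite alphabets; at probability zero the total function
    \<open>log\<close> still has a real value, so every pair of letters can be included.\<close>
  define c where "c = Max ((\<lambda>(a, b). \<bar>- log 2 (pmf (ch a) b)\<bar>) ` UNIV \<union>
    (\<lambda>b. \<bar>- log 2 (pmf (bind_pmf p0 ch) b)\<bar>) ` UNIV)"
  have HY: "entropy2 (joint_pmf p0 ch) snd = b"
    unfolding b_def by (subst entropy2_eq_pmf_entropy) (simp_all add: map_snd_joint_pmf)
  have HYX: "conditional_entropy2 (joint_pmf p0 ch) snd fst = a"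
    unfolding a_def by (rule conditional_entropy2_joint_pmf)
  have I: "mutual_information2 (joint_pmf p0 ch) fst snd = b - a"
    unfolding mutual_information2_joint_pmf HY HYX ..
  \<comment> \<open>For small \<open>n\<close> the typical set may have low or zero probability; the
    limits depend only on large \<open>n\<close>.\<close>
  have ev: "\<forall>\<^sub>F n in sequentially. typical_transmission p0 ch \<epsilon> R c n"
    using eventually_prob_strongly_typical_ge[OF assms(1), of p0] eventually_gt_at_top[of 0]
  proof eventually_elim
    case (elim n)
    have "\<bar>- log 2 (pmf (ch a) b)\<bar> \<le> c" for a b
      unfolding c_def by (rule Max_ge) (auto intro!: image_eqI[of _ _ "(a, b)"])
    moreover have "\<bar>- log 2 (pmf (bind_pmf p0 ch) b)\<bar> \<le> c" for b
      unfolding c_def by (rule Max_ge) auto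
    ultimately show ?case
      using elim assms by unfold_locales auto
  qed
  have "(\<lambda>n. avg_conditional_entropy2 (transmission_pmf p0 ch \<epsilon> R n) output_block codebook / real n)
      \<longlonglongrightarrow> min (R + a) b"
  proof (rule tendsto_rate_of_sqrt_deviation)
    show "\<forall>\<^sub>F n in sequentially.
      \<bar>avg_conditional_entropy2 (transmission_pmf p0 ch \<epsilon> R n) output_block codebook
        - real n * min (R + a) b\<bar> \<le> (16 * c + 2) * sqrt (real n)"
      using ev
    proof eventually_elim
      case (elim n)
      interpret typical_transmission p0 ch \<epsilon> R c n by fact
      show ?case
        using avg_entropy_deviation
        by (simp add: avg_conditional_entropy2_transmission_pmf codebook_pmf_def a_def b_def)
    qed
  qed
  moreover have "(\<lambda>n. entropy2 (transmission_pmf p0 ch \<epsilon> R n) output_block / real n) \<longlonglongrightarrow> b"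
  proof (rule tendsto_rate_of_sqrt_deviation)
    show "\<forall>\<^sub>F n in sequentially. \<bar>entropy2 (transmission_pmf p0 ch \<epsilon> R n) output_block - real n * b\<bar>
      \<le> (8 * c + 1) * sqrt (real n)"
      using ev
    proof eventually_elim
      case (elim n)
      interpret typical_transmission p0 ch \<epsilon> R c n by fact
      have "entropy2 (transmission_pmf p0 ch \<epsilon> R n) output_block = pmf_entropy (bind_pmf q K)"
        by (subst entropy2_eq_pmf_entropy) (simp_all only: map_output_block_transmission_pmf, simp)
      thus ?case
        using output_entropy_deviation by (simp add: b_def)
    qed
  qed
  \<comment> \<open>The minimum of \<open>R + a\<close> and \<open>b\<close> changes branch at
    \<open>R = b - a\<close>, which is the mutual information.\<close>
  ultimately show ?thesis
    unfolding HY HYX I by (auto simp: min_def split: if_splits)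
qed

end
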